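(* Let $J$ be the $K_1$-nilradical of a Leibniz $n$-algebra $L$. Then for every derivation $d$ of $L$ we have $d(J)\subseteq J$.
   Context: A Leibniz $n$-algebra is a vector space $L$ with an $n$-linear multiplication $[-,\dots,-]$ satisfying $[[x_1,\dots,x_n],y_2,\dots,y_n]=\sum_{i=1}^n[x_1,\dots,x_{i-1},[x_i,y_2,\dots,y_n],x_{i+1},\dots,x_n]$. A derivation is a linear map $d:L\to L$ with $d([x_1,\dots,x_n])=\sum_{i=1}^n[x_1,\dots,d(x_i),\dots,x_n]$. An ideal is a subspace $I$ such that a product of $n$ elements lies in $I$ whenever at least one of the factors (in any position) lies in $I$. For an ideal $I$ put $I^{[1]}=I$ and $I^{[k+1]}=[I^{[k]},I,L,\dots,L]$ (linear span of the products with first entry in $I^{[k]}$, second entry in $I$, remaining entries in $L$). The ideal $I$ is $K_1$-nilpotent if $I^{[k]}=0$ for some $k\in\mathbb{N}$. The $K_1$-nilradical is defined for finite-dimensional $L$: it is the maximal $K_1$-nilpotent ideal of $L$, i.e. the sum of all $K_1$-nilpotent ideals of $L$.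
   Formalization: The ground field is assumed to have characteristic 0; in characteristic p ≥ 3 the claim fails, e.g. for n = 2, L = sl_2 ⊗ F[x]/(x^p) with the derivation id ⊗ d/dx, which maps sl_2 ⊗ (x) = J outside J. *)

theory Defs
  imports Complex_Main
begin

text \<open>
  The vector space is the whole type \<open>'b\<close>. The bracket takes its \<open>n\<close> arguments as a list and is
  unconstrained on lists of any other length; \<open>xs[i := v]\<close> is \<open>xs\<close> with its
  \<open>i\<close>-th entry (counted from \<open>0\<close>) replaced by \<open>v\<close>.
\<close>

locale leibniz_n_algebra = vector_space scale
  for scale :: "'a::field \<Rightarrow> 'b::ab_group_add \<Rightarrow> 'b" +
  fixes n :: nat and br :: "'b list \<Rightarrow> 'b"
  assumes n_ge_2: "n \<ge> 2"
    and multilinear: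
      "\<And>xs i. length xs = n \<Longrightarrow> i < n \<Longrightarrow> Vector_Spaces.linear scale scale (\<lambda>v. br (xs[i := v]))"
    and leibniz_identity:
      "\<And>xs ys. length xs = n \<Longrightarrow> length ys = n - 1 \<Longrightarrow>
        br (br xs # ys) = (\<Sum>i<n. br (xs[i := br (xs ! i # ys)]))"
begin

definition derivation :: "('b \<Rightarrow> 'b) \<Rightarrow> bool" where
  "derivation d \<longleftrightarrow> Vector_Spaces.linear scale scale d \<and>
    (\<forall>xs. length xs = n \<longrightarrow> d (br xs) = (\<Sum>i<n. br (xs[i := d (xs ! i)])))"

definition ideal :: "'b set \<Rightarrow> bool" where
  "ideal I \<longleftrightarrow> subspace I \<and>
    (\<forall>xs. length xs = n \<and> (\<exists>i<n. xs ! i \<in> I) \<longrightarrow> br xs \<in> I)"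

text \<open>The index is shifted by one: \<open>K1_series I k\<close> is \<open>I\<^sup>[\<^sup>k\<^sup>+\<^sup>1\<^sup>]\<close>.\<close>

primrec K1_series :: "'b set \<Rightarrow> nat \<Rightarrow> 'b set" where
  "K1_series I 0 = I"
| "K1_series I (Suc k) =
    span {br (x # y # zs) | x y zs. x \<in> K1_series I k \<and> y \<in> I \<and> length zs = n - 2}"

definition K1_nilpotent :: "'b set \<Rightarrow> bool" where
  "K1_nilpotent I \<longleftrightarrow> (\<exists>k. K1_series I k = {0})"

text \<open>The sum of a family of subspaces is the span of its union.\<close>

definition K1_nilradical :: "'b set" where
  "K1_nilradical = span (\<Union>{I. ideal I \<and> K1_nilpotent I})"

end

end

(*
  It suffices to embed d(I), for a single K1-nilpotent ideal I, into a K1-nilpotent ideal; the ideal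
  is I + d(I).  Consider the associative algebra generated by the right multiplications
  x |-> [x, y_2, ..., y_n], filtered by the number k of factors with y_2 in I.  Right multiplications
  are derivations, so an operator of filtration degree k >= 1 maps L into I^[k], and the filtration
  vanishes in degree m + 1 if I^[m+1] = 0.  Bracketing with d is a derivation D of this algebra that
  lowers the degree by at most one, whence D^k(p_1 ... p_k) = k! D(p_1) ... D(p_k) modulo degree 1
  for p_i of degree 1.  In characteristic 0 a product of m + 1 operators D(p_i) therefore has degree
  at least 1, and a product of (m + 1)^2 of them vanishes.  Up to degree 1, the right
  multiplications with y_2 in I + d(I) are of the form D(p).
*)

theory Submission
  imports Defs "HOL-Library.Function_Algebras"
begin

section \<open>Right multiplications and the series of an ideal\<close>

context leibniz_n_algebra
begin

lemma br_add:
  assumes "length xs = n" "i < n"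
  shows "br (xs[i := u + v]) = br (xs[i := u]) + br (xs[i := v])"
proof -
  interpret Vector_Spaces.linear scale scale "\<lambda>v. br (xs[i := v])"
    using assms by (rule multilinear)
  show ?thesis by (rule add)
qed

definition rmult :: "'b list \<Rightarrow> 'b \<Rightarrow> 'b" where
  "rmult ys x = br (x # ys)"

lemma linear_rmult: "length ys = n - 1 \<Longrightarrow> Vector_Spaces.linear scale scale (rmult ys)"
  using multilinear[of "0 # ys" 0] n_ge_2 by (simp add: rmult_def[abs_def])

lemma ideal_br: "ideal I \<Longrightarrow> length xs = n \<Longrightarrow> i < n \<Longrightarrow> xs ! i \<in> I \<Longrightarrow> br xs \<in> I"
  unfolding ideal_def by blast

lemma subspace_K1_series: "ideal I \<Longrightarrow> subspace (K1_series I k)"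
  by (cases k) (simp_all add: ideal_def)

lemma br_in_K1_series_Suc:
  assumes "length xs = n" "xs ! 0 \<in> K1_series I k" "xs ! 1 \<in> I"
  shows "br xs \<in> K1_series I (Suc k)"
proof -
  obtain x y zs where "xs = x # y # zs" "length zs = n - 2"
    using assms(1) n_ge_2
    by (metis One_nat_def Suc_1 Suc_le_length_iff diff_Suc_1 diff_Suc_Suc length_Cons)
  with assms(2,3) show ?thesis
    by (auto intro!: span_base)
qed

text \<open>By the Leibniz identity right multiplication is a derivation. Applied to a generator of
  the next term it hits the first entry (induction hypothesis), the second (\<open>I\<close> is an
  ideal) or a later one, which is arbitrary anyway.\<close>

lemma K1_series_rmult:
  assumes I: "ideal I" and ys: "length ys = n - 1"
  shows "x \<in> K1_series I k \<Longrightarrow> rmult ys x \<in> K1_series I k"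
proof (induction k arbitrary: x)
  case 0
  show ?case
    using ideal_br[OF I, of "x # ys" 0] 0 ys n_ge_2 by (simp add: rmult_def)
next
  case (Suc k)
  interpret r: Vector_Spaces.linear scale scale "rmult ys" by (rule linear_rmult[OF ys])
  let ?G = "{br (x # y # zs) | x y zs. x \<in> K1_series I k \<and> y \<in> I \<and> length zs = n - 2}"
  have sub: "subspace (K1_series I (Suc k))" by (rule subspace_K1_series[OF I])
  have "x \<in> span ?G" using Suc.prems by simp
  then have "rmult ys x \<in> K1_series I (Suc k)"
  proof (rule span_induct)
    show "subspace {x. rmult ys x \<in> K1_series I (Suc k)}"
      using sub unfolding subspace_def by (auto simp: r.add r.scale r.zero)
  next
    fix g assume "g \<in> ?G"
    then obtain x y zs where g: "g = br (x # y # zs)" and x: "x \<in> K1_series I k"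
      and y: "y \<in> I" and zs: "length zs = n - 2" by blast
    let ?xs = "x # y # zs"
    have len: "length ?xs = n" using zs n_ge_2 by simp
    have "br (?xs[i := br (?xs ! i # ys)]) \<in> K1_series I (Suc k)" for i
    proof (rule br_in_K1_series_Suc)
      show "length (?xs[i := br (?xs ! i # ys)]) = n" using len by (simp only: length_list_update)
      have "br (x # ys) \<in> K1_series I k" using Suc.IH[OF x] by (simp add: rmult_def)
      then show "?xs[i := br (?xs ! i # ys)] ! 0 \<in> K1_series I k"
        using x by (cases i) simp_all
      have "br (y # ys) \<in> I"
        using ideal_br[OF I, of "y # ys" 0] y ys n_ge_2 by simp
      then show "?xs[i := br (?xs ! i # ys)] ! 1 \<in> I"
        using y zs by (cases i; cases "i - 1") simp_all
    qed
    then have "(\<Sum>i<n. br (?xs[i := br (?xs ! i # ys)])) \<in> K1_series I (Suc k)"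
      by (intro subspace_sum[OF sub]) auto
    then show "rmult ys g \<in> K1_series I (Suc k)"
      using leibniz_identity[OF len ys] by (simp add: g rmult_def)
  qed
  then show ?case by simp
qed

end

section \<open>The filtered algebra generated by right multiplications\<close>

locale ideal_with_derivation = leibniz_n_algebra scale n br
  for scale :: "'a::field_char_0 \<Rightarrow> 'b::ab_group_add \<Rightarrow> 'b" and n br +
  fixes I :: "'b set" and d :: "'b \<Rightarrow> 'b"
  assumes ideal: "ideal I" and derivation: "derivation d"
begin

sublocale d: Vector_Spaces.linear scale scale d
  using derivation by (simp add: derivation_def)

lemma derivation_br: "length xs = n \<Longrightarrow> d (br xs) = (\<Sum>i<n. br (xs[i := d (xs ! i)]))"
  using derivation by (simp add: derivation_def)

text \<open>\<open>mult_op k\<close> is the span of the products of right multiplications in which at least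
  \<open>k\<close> factors have their first entry in \<open>I\<close>.\<close>

inductive mult_op :: "nat \<Rightarrow> ('b \<Rightarrow> 'b) \<Rightarrow> bool" where
  id: "mult_op 0 id"
| rmult: "length ys = n - 1 \<Longrightarrow> mult_op k f \<Longrightarrow> mult_op k (rmult ys \<circ> f)"
| rmult_ideal: "length ys = n - 1 \<Longrightarrow> ys ! 0 \<in> I \<Longrightarrow> mult_op k f \<Longrightarrow> mult_op (Suc k) (rmult ys \<circ> f)"
| zero: "mult_op k 0"
| add: "mult_op k f \<Longrightarrow> mult_op k g \<Longrightarrow> mult_op k (f + g)"
| scale: "mult_op k f \<Longrightarrow> mult_op k (\<lambda>x. scale c (f x))"

lemma mult_op_diff:
  assumes "mult_op k f" "mult_op k g" shows "mult_op k (f - g)"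
proof -
  have "f - g = f + (\<lambda>x. scale (-1) (g x))" by (simp add: fun_eq_iff)
  with assms show ?thesis by (simp only: mult_op.add mult_op.scale)
qed

lemma mult_op_sum:
  assumes "\<And>i. i \<in> A \<Longrightarrow> mult_op k (f i)" shows "mult_op k (\<lambda>x. \<Sum>i\<in>A. f i x)"
proof (cases "finite A")
  case True
  then show ?thesis using assms
  proof induction
    case empty
    then show ?case using mult_op.zero[of k] by (simp add: zero_fun_def)
  next
    case (insert a A)
    then have "mult_op k (f a + (\<lambda>x. \<Sum>i\<in>A. f i x))"
      by (intro mult_op.add) auto
    with insert.hyps show ?case by (simp add: plus_fun_def)
  qed
next
  case False
  then show ?thesis using mult_op.zero[of k] by (simp add: zero_fun_def)
qed

lemma mult_op_pred: "mult_op k f \<Longrightarrow> mult_op (k - 1) f"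
proof (induction rule: mult_op.induct)
  case (rmult_ideal ys k f)
  then have "mult_op k (rmult ys \<circ> f)" by (intro mult_op.rmult)
  then show ?case by (simp only: diff_Suc_1)
qed (simp_all only: diff_0_eq_0 mult_op.intros)

lemma mult_op_mono: "mult_op k f \<Longrightarrow> j \<le> k \<Longrightarrow> mult_op j f"
proof (induction k)
  case (Suc k)
  then show ?case using mult_op_pred[of "Suc k" f] by (cases "j = Suc k") auto
qed simp

text \<open>Induction on the left factor only: on that side sums and scalars pass through
  composition without linearity of \<open>g\<close>.\<close>

lemma mult_op_comp: "mult_op j f \<Longrightarrow> mult_op k g \<Longrightarrow> mult_op (j + k) (f \<circ> g)"
proof (induction rule: mult_op.induct)
  case (add j f f')
  have "(f + f') \<circ> g = (f \<circ> g) + (f' \<circ> g)" by (simp add: fun_eq_iff)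
  with add show ?case by (simp only: mult_op.add)
next
  case (scale j f c)
  then have "mult_op (j + k) (\<lambda>x. scale c ((f \<circ> g) x))" by (blast intro: mult_op.scale)
  then show ?case by (simp only: comp_def)
next
  case (zero j)
  have "0 \<circ> g = (0 :: 'b \<Rightarrow> 'b)" by (simp add: fun_eq_iff)
  then show ?case by (simp only: mult_op.zero)
qed (simp_all only: comp_assoc add_0 id_comp add_Suc mult_op.intros)

text \<open>Supplies the hypothesis of the product rule \<open>ad_comp\<close>.\<close>

lemma mult_op_linear: "mult_op k f \<Longrightarrow> Vector_Spaces.linear scale scale f"
proof (induction rule: mult_op.induct)
  case id
  show ?case by (rule linear_id)
next
  case (rmult ys k f)
  then show ?case using Vector_Spaces.linear_compose[OF _ linear_rmult] by blast
next
  case (rmult_ideal ys k f)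
  then show ?case using Vector_Spaces.linear_compose[OF _ linear_rmult] by blast
next
  case (zero k)
  show ?case by unfold_locales simp_all
next
  case (add k f g)
  interpret f: Vector_Spaces.linear scale scale f by fact
  interpret g: Vector_Spaces.linear scale scale g by fact
  show ?case by unfold_locales (simp_all add: f.add f.scale g.add g.scale scale_right_distrib)
next
  case (scale k f c)
  interpret f: Vector_Spaces.linear scale scale f by fact
  show ?case by unfold_locales (simp_all add: f.add f.scale scale_right_distrib mult.commute)
qed

text \<open>The first applied factor with an entry in \<open>I\<close> maps everything into
  \<open>I\<close>, each further one advances the series, and the other factors preserve it by
  \<open>K1_series_rmult\<close>. By the index shift \<open>K1_series I (k - 1)\<close> is
  I^[k].\<close>

lemma mult_op_K1_series: "mult_op k f \<Longrightarrow> k > 0 \<Longrightarrow> f x \<in> K1_series I (k - 1)"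
proof (induction rule: mult_op.induct)
  case (rmult ys k f)
  then show ?case using K1_series_rmult[OF ideal] by simp
next
  case (rmult_ideal ys k f)
  show ?case
  proof (cases k)
    case 0
    then show ?thesis
      using ideal_br[OF ideal, of "f x # ys" 1] rmult_ideal.hyps n_ge_2 by (simp add: rmult_def)
  next
    case (Suc j)
    then show ?thesis
      using br_in_K1_series_Suc[of "f x # ys" I j] rmult_ideal n_ge_2 by (simp add: rmult_def)
  qed
next
  case (zero k)
  then show ?case using subspace_0[OF subspace_K1_series[OF ideal]] by simp
next
  case (add k f g)
  then show ?case using subspace_add[OF subspace_K1_series[OF ideal]] by simp
next
  case (scale k f c)
  then show ?case using subspace_scale[OF subspace_K1_series[OF ideal]] by simp
qed simp

section \<open>Commutators with the derivation\<close>

definition ad :: "('b \<Rightarrow> 'b) \<Rightarrow> 'b \<Rightarrow> 'b" where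
  "ad f = (d \<circ> f) - (f \<circ> d)"

lemma ad_zero [simp]: "ad 0 = 0"
  by (simp add: ad_def fun_eq_iff d.zero)

lemma ad_diff: "ad (f - g) = ad f - ad g"
  by (simp add: ad_def fun_eq_iff d.diff)

lemma ad_add: "ad (f + g) = ad f + ad g"
  by (simp add: ad_def fun_eq_iff d.add)

lemma ad_scale: "ad (\<lambda>x. scale c (f x)) = (\<lambda>x. scale c (ad f x))"
  by (simp add: ad_def fun_eq_iff d.scale scale_right_diff_distrib)

text \<open>Linearity of \<open>f\<close> splits \<open>f (d (g x) - g (d x))\<close>, so that the
  two terms \<open>f (d (g x))\<close> cancel.\<close>

lemma ad_comp:
  assumes "Vector_Spaces.linear scale scale f"
  shows "ad (f \<circ> g) = (ad f \<circ> g) + (f \<circ> ad g)"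
proof -
  interpret f: Vector_Spaces.linear scale scale f by fact
  show ?thesis by (simp add: ad_def fun_eq_iff f.diff)
qed

text \<open>The term of the derivation rule that differentiates \<open>x\<close> is
  \<open>rmult ys (d x)\<close>, which the commutator subtracts.\<close>

lemma ad_rmult:
  assumes "length ys = n - 1"
  shows "ad (rmult ys) = (\<lambda>x. \<Sum>i<n - 1. rmult (ys[i := d (ys ! i)]) x)"
proof
  fix x
  obtain m where m: "n = Suc m" using n_ge_2 by (cases n) auto
  have "d (br (x # ys)) = (\<Sum>i<Suc m. br ((x # ys)[i := d ((x # ys) ! i)]))"
    using derivation_br[of "x # ys"] assms m by simp
  then show "ad (rmult ys) x = (\<Sum>i<n - 1. rmult (ys[i := d (ys ! i)]) x)"
    by (simp add: ad_def rmult_def m sum.lessThan_Suc_shift add_diff_eq del: sum.lessThan_Suc)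
qed

lemma mult_op_ad_rmult_comp:
  assumes ys: "length ys = n - 1" and f: "mult_op k f"
  shows "mult_op k (ad (rmult ys) \<circ> f)"
proof -
  have "mult_op k (\<lambda>x. \<Sum>i<n - 1. (rmult (ys[i := d (ys ! i)]) \<circ> f) x)"
    using ys f by (intro mult_op_sum mult_op.rmult) auto
  then show ?thesis by (simp add: ad_rmult[OF ys] comp_def)
qed

text \<open>By the product rule each term differentiates one factor. Only that factor can lose its
  first entry from \<open>I\<close>, so the degree drops by at most one.\<close>

lemma mult_op_ad: "mult_op k f \<Longrightarrow> mult_op (k - 1) (ad f)"
proof (induction rule: mult_op.induct)
  case id
  have "ad id = 0" by (simp add: ad_def fun_eq_iff)
  then show ?case by (simp only: mult_op.zero)
next
  case (rmult ys k f)
  have "mult_op (k - 1) (ad (rmult ys) \<circ> f)"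
    using mult_op_mono[OF mult_op_ad_rmult_comp[OF rmult.hyps(1,2)]] by simp
  with rmult show ?case
    by (simp only: ad_comp[OF linear_rmult] mult_op.add mult_op.rmult)
next
  case (rmult_ideal ys k f)
  have "mult_op k (ad (rmult ys) \<circ> f)"
    using mult_op_ad_rmult_comp rmult_ideal.hyps by blast
  \<comment> \<open>The rule gives degree \<open>Suc (k - 1)\<close>, which is 1 rather than
    \<open>k\<close> when \<open>k = 0\<close>; hence the weakening.\<close>
  moreover have "mult_op k (rmult ys \<circ> ad f)"
    using mult_op_mono[OF mult_op.rmult_ideal[OF rmult_ideal.hyps(1,2) rmult_ideal.IH]] by simp
  ultimately show ?case
    using rmult_ideal.hyps(1) by (simp only: diff_Suc_1 ad_comp[OF linear_rmult] mult_op.add)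
qed (simp_all only: ad_zero ad_add ad_scale mult_op.intros)

lemma mult_op_ad_funpow: "mult_op k f \<Longrightarrow> mult_op (k - j) ((ad ^^ j) f)"
proof (induction j)
  case (Suc j)
  then show ?case using mult_op_ad[of "k - j" "(ad ^^ j) f"] by simp
qed simp

text \<open>Up to higher order only two terms of the Leibniz rule survive: those with at least two
  derivatives on \<open>p\<close> have degree at least \<open>k + 2 - j\<close>. (For \<open>j = 0\<close> the truncated exponent
  \<open>j - 1\<close> is harmless, as its coefficient vanishes.)\<close>

lemma ad_funpow_comp:
  assumes p: "mult_op 1 p" and q: "mult_op k q"
  shows "mult_op (k + 2 - j)
    ((ad ^^ j) (p \<circ> q) - (p \<circ> (ad ^^ j) q) - (\<lambda>x. scale (of_nat j) ((ad p \<circ> (ad ^^ (j - 1)) q) x)))"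
proof -
  define E where "E j = (ad ^^ j) (p \<circ> q) - (p \<circ> (ad ^^ j) q)
    - (\<lambda>x. scale (of_nat j) ((ad p \<circ> (ad ^^ (j - 1)) q) x))" for j
  define r where "r j = (\<lambda>x. scale (of_nat j) ((ad (ad p) \<circ> (ad ^^ (j - 1)) q) x))" for j
  have lp: "Vector_Spaces.linear scale scale p" by (rule mult_op_linear[OF p])
  have adp: "mult_op 0 (ad p)" using mult_op_ad[OF p] by simp
  have ladp: "Vector_Spaces.linear scale scale (ad p)" by (rule mult_op_linear[OF adp])
  have E0: "E 0 = 0" by (simp add: E_def fun_eq_iff)
  \<comment> \<open>Differentiating the defect \<open>E j\<close> yields \<open>ad p\<close>
    composed with \<open>(ad ^^ j) q\<close> once from the second term and \<open>j\<close> times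
    from the third, together the coefficient \<open>j + 1\<close>. What is left over is
    \<open>r j\<close>, with two derivatives on \<open>p\<close>.\<close>
  have E_Suc: "E (Suc j) = ad (E j) + r j" for j
  proof (cases j)
    case 0
    have "E (Suc 0) = 0" by (simp add: E_def ad_comp[OF lp] fun_eq_iff)
    moreover have "r 0 = 0" by (simp add: r_def fun_eq_iff)
    ultimately show ?thesis by (simp add: 0 E0)
  next
    case (Suc i)
    have ad_E: "ad (E j) = (ad ^^ Suc j) (p \<circ> q) - ((ad p \<circ> (ad ^^ j) q) + (p \<circ> (ad ^^ Suc j) q))
      - (\<lambda>x. scale (of_nat j) (((ad (ad p) \<circ> (ad ^^ i) q) + (ad p \<circ> (ad ^^ j) q)) x))"
      by (simp only: E_def ad_diff ad_scale ad_comp[OF lp] ad_comp[OF ladp] Suc diff_Suc_1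
          funpow.simps(2) comp_apply[of ad])
    have "j - 1 = i" using Suc by simp
    then show ?thesis
      unfolding ad_E by (simp add: E_def r_def fun_eq_iff scale_left_distrib scale_right_distrib)
  qed
  have r: "mult_op (k + 2 - Suc j) (r j)" for j
  proof (cases j)
    case 0
    then have "r j = 0" by (simp add: r_def fun_eq_iff)
    then show ?thesis by (simp only: mult_op.zero)
  next
    case (Suc i)
    have "mult_op 0 (ad (ad p))" using mult_op_ad[OF adp] by simp
    from mult_op_comp[OF this mult_op_ad_funpow[OF q, of i]]
    have "mult_op (k + 2 - Suc j) (ad (ad p) \<circ> (ad ^^ (j - 1)) q)" using Suc by simp
    then show ?thesis unfolding r_def by (rule mult_op.scale)
  qed
  have "mult_op (k + 2 - j) (E j)"
  proof (induction j)
    case 0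
    show ?case by (simp only: E0 mult_op.zero)
  next
    case (Suc j)
    have "mult_op (k + 2 - Suc j) (ad (E j))"
      using mult_op_ad[OF Suc.IH] by (simp only: diff_diff_left Suc_eq_plus1)
    then show ?case by (simp only: E_Suc mult_op.add r)
  qed
  then show ?thesis by (simp only: E_def)
qed

text \<open>Modulo degree 1, D^(k+1)(p q) = (k+1) D(p) D^k(q) by \<open>ad_funpow_comp\<close>, so
  q' = p q / (k+1) works.\<close>

lemma ad_comp_ad_funpow:
  assumes p: "mult_op 1 p" and q: "mult_op k q"
  shows "\<exists>q'. mult_op (Suc k) q' \<and> mult_op 1 ((ad p \<circ> (ad ^^ k) q) - (ad ^^ Suc k) q')"
proof -
  \<comment> \<open>Characteristic 0 enters here, to divide by \<open>k + 1\<close>.\<close>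
  define c :: 'a where "c = 1 / of_nat (Suc k)"
  define p' where "p' = (\<lambda>x. scale c (p x))"
  have p': "mult_op 1 p'" unfolding p'_def using p by (rule mult_op.scale)
  let ?h = "\<lambda>x. scale (of_nat (Suc k)) ((ad p' \<circ> (ad ^^ k) q) x)"
  have nz: "of_nat (Suc k) * c = 1"
    by (simp add: c_def del: of_nat_Suc)
  have h: "?h = ad p \<circ> (ad ^^ k) q"
    by (simp add: p'_def ad_scale fun_eq_iff nz del: of_nat_Suc)
  \<comment> \<open>Both error terms have degree 1: \<open>?E\<close> since
    \<open>k + 2 - Suc k = 1\<close>, the composite with \<open>p'\<close> on the left since
    \<open>1 + (k - Suc k) = 1\<close>.\<close>
  let ?E = "(ad ^^ Suc k) (p' \<circ> q) - (p' \<circ> (ad ^^ Suc k) q) - ?h"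
  have "mult_op 1 ?E"
    using ad_funpow_comp[OF p' q, of "Suc k"] by simp
  moreover have "mult_op 1 (p' \<circ> (ad ^^ Suc k) q)"
    using mult_op_comp[OF p' mult_op_ad_funpow[OF q, of "Suc k"]] by simp
  ultimately have "mult_op 1 (0 - (?E + (p' \<circ> (ad ^^ Suc k) q)))"
    using mult_op_diff[OF mult_op.zero mult_op.add] by blast
  moreover have "0 - (?E + (p' \<circ> (ad ^^ Suc k) q)) = ?h - (ad ^^ Suc k) (p' \<circ> q)"
    by (simp add: fun_eq_iff)
  ultimately have "mult_op 1 ((ad p \<circ> (ad ^^ k) q) - (ad ^^ Suc k) (p' \<circ> q))"
    by (simp only: h)
  moreover have "mult_op (Suc k) (p' \<circ> q)"
    using mult_op_comp[OF p' q] by simp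
  ultimately show ?thesis by blast
qed

section \<open>The ideal I + d(I)\<close>

definition extended :: "'b set" where
  "extended = {a + d b | a b. a \<in> I \<and> b \<in> I}"

lemma subspace_I: "subspace I"
  using ideal by (simp add: ideal_def)

lemma subspace_extended: "subspace extended"
  unfolding extended_def
  using subspace_sums[OF subspace_I d.subspace_image[OF subspace_I]]
  by (rule back_subst[where P = subspace]) blast

lemma I_extended: "a \<in> I \<Longrightarrow> a \<in> extended"
  unfolding extended_def using subspace_0[OF subspace_I] by force

lemma d_extended: "b \<in> I \<Longrightarrow> d b \<in> extended"
  unfolding extended_def using subspace_0[OF subspace_I] by force

text \<open>A product with entry \<open>d b\<close> is \<open>d\<close> of the product with entry
  \<open>b\<close>, minus the other terms of the derivation rule; those still contain
  \<open>b\<close> and so lie in \<open>I\<close>.\<close>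

lemma ideal_extended: "ideal extended"
  unfolding ideal_def
proof (intro conjI allI impI)
  show "subspace extended" by (rule subspace_extended)
  fix xs assume "length xs = n \<and> (\<exists>i<n. xs ! i \<in> extended)"
  then obtain i a b where len: "length xs = n" and i: "i < n" and xi: "xs ! i = a + d b"
    and a: "a \<in> I" and b: "b \<in> I"
    unfolding extended_def by blast
  let ?ys = "xs[i := b]"
  let ?t = "\<lambda>j. br (?ys[j := d (?ys ! j)])"
  have "br xs = br (xs[i := a]) + br (xs[i := d b])"
    using br_add[OF len i, of a "d b"] by (simp flip: xi)
  moreover have "br (xs[i := d b]) = d (br ?ys) - (\<Sum>j\<in>{..<n} - {i}. ?t j)"
    using derivation_br[of ?ys] len i by (simp add: sum.remove[of "{..<n}" i])
  moreover have "br (xs[i := a]) \<in> extended"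
    using ideal_br[OF ideal, of "xs[i := a]" i] len i a by (simp add: I_extended)
  moreover have "d (br ?ys) \<in> extended"
    using ideal_br[OF ideal, of ?ys i] len i b by (simp add: d_extended)
  moreover have "(\<Sum>j\<in>{..<n} - {i}. ?t j) \<in> extended"
  proof (rule subspace_sum[OF subspace_extended])
    fix j assume "j \<in> {..<n} - {i}"
    then show "?t j \<in> extended"
      using ideal_br[OF ideal, of "?ys[j := d (?ys ! j)]" i] len i b by (simp add: I_extended)
  qed
  ultimately show "br xs \<in> extended"
    by (simp add: subspace_add subspace_diff subspace_extended)
qed

text \<open>If the first entry of \<open>ys\<close> is a + d(b), take for \<open>p\<close> the right
  multiplication with that entry replaced by \<open>b\<close>. In D(p) the term with first entry
  d(b) is the wanted one; the others have first entry \<open>b\<close>, and the remaining part with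
  first entry \<open>a\<close> has degree 1 as well.\<close>

lemma rmult_extended:
  assumes ys: "length ys = n - 1" and "ys ! 0 \<in> extended"
  shows "\<exists>p. mult_op 1 p \<and> mult_op 1 (rmult ys - ad p)"
proof -
  obtain a b where ab: "ys ! 0 = a + d b" "a \<in> I" "b \<in> I"
    using assms(2) unfolding extended_def by blast
  have op1: "mult_op 1 (rmult zs)" if "length zs = n - 1" "zs ! 0 \<in> I" for zs
    using mult_op.rmult_ideal[OF that mult_op.id] by simp
  let ?zs = "ys[0 := b]"
  let ?t = "\<lambda>i. rmult (?zs[i := d (?zs ! i)])"
  have n1: "0 < n - 1" using n_ge_2 by simp
  have "rmult ys x - ad (rmult ?zs) x
      = rmult (ys[0 := a]) x - (\<Sum>i\<in>{..<n - 1} - {0}. ?t i x)" for x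
  proof -
    have "rmult ys x = rmult (ys[0 := a]) x + rmult (ys[0 := d b]) x"
      using br_add[of "x # ys" 1 a "d b"] ys n_ge_2 by (simp add: rmult_def flip: ab(1))
    moreover have "ad (rmult ?zs) x = rmult (ys[0 := d b]) x + (\<Sum>i\<in>{..<n - 1} - {0}. ?t i x)"
      using ys n1 sum.remove[of "{..<n - 1}" 0 "\<lambda>i. ?t i x"] by (simp add: ad_rmult)
    ultimately show ?thesis by simp
  qed
  then have "rmult ys - ad (rmult ?zs)
      = rmult (ys[0 := a]) - (\<lambda>x. \<Sum>i\<in>{..<n - 1} - {0}. ?t i x)"
    by (simp add: fun_eq_iff)
  moreover have "mult_op 1 (rmult (ys[0 := a]))"
    using ys n1 ab by (intro op1) auto
  moreover have "mult_op 1 (\<lambda>x. \<Sum>i\<in>{..<n - 1} - {0}. ?t i x)"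
    using ys n1 ab by (intro mult_op_sum op1) auto
  moreover have "mult_op 1 (rmult ?zs)"
    using ys n1 ab by (intro op1) auto
  ultimately show ?thesis
    by (intro exI[of _ "rmult ?zs"]) (simp only: mult_op_diff simp_thms)
qed

section \<open>Nilpotency of I + d(I)\<close>

inductive ext_word :: "nat \<Rightarrow> ('b \<Rightarrow> 'b) \<Rightarrow> bool" where
  id: "ext_word 0 id"
| rmult: "length ys = n - 1 \<Longrightarrow> ys ! 0 \<in> extended \<Longrightarrow> ext_word k f \<Longrightarrow> ext_word (Suc k) (rmult ys \<circ> f)"

text \<open>Unlike \<open>mult_op\<close>, \<open>ext_word\<close> admits no sums or scalars, so a
  product of exact length can be cut anywhere, later into blocks of \<open>m + 1\<close>
  factors.\<close>

lemma ext_word_split: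
  "ext_word m f \<Longrightarrow> m = j + k \<Longrightarrow> \<exists>g h. ext_word j g \<and> ext_word k h \<and> f = g \<circ> h"
proof (induction arbitrary: j rule: ext_word.induct)
  case id
  then show ?case by (metis add_is_0 comp_id ext_word.id)
next
  case (rmult ys m f)
  show ?case
  proof (cases j)
    case 0
    have "ext_word (Suc m) (rmult ys \<circ> f)"
      using rmult.hyps by (rule ext_word.rmult)
    moreover have "Suc m = k" using 0 rmult.prems by simp
    ultimately show ?thesis using 0 ext_word.id id_comp by metis
  next
    case (Suc i)
    with rmult.prems rmult.IH[of i] obtain g h
      where "ext_word i g" "ext_word k h" "f = g \<circ> h" by (metis add_Suc nat.inject)
    then have "ext_word j (rmult ys \<circ> g)" "rmult ys \<circ> f = (rmult ys \<circ> g) \<circ> h"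
      using Suc rmult.hyps(1,2) by (simp_all only: comp_assoc ext_word.rmult)
    with \<open>ext_word k h\<close> show ?thesis by blast
  qed
qed

text \<open>Modulo degree 1 every factor is some D(p), and \<open>ad_comp_ad_funpow\<close> absorbs
  the factors one at a time into a single k-th derivative.\<close>

lemma ext_word_ad:
  "ext_word k f \<Longrightarrow> \<exists>q. mult_op k q \<and> mult_op 1 (f - (ad ^^ k) q)"
proof (induction rule: ext_word.induct)
  case id
  have "id - (ad ^^ 0) id = 0" by simp
  then have "mult_op 1 (id - (ad ^^ 0) id)" by (simp only: mult_op.zero)
  then show ?case using mult_op.id by blast
next
  case (rmult ys k f)
  let ?T = "rmult ys"
  obtain p where p: "mult_op 1 p" "mult_op 1 (?T - ad p)"
    using rmult_extended rmult.hyps by blast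
  obtain q where q: "mult_op k q" "mult_op 1 (f - (ad ^^ k) q)"
    using rmult.IH by blast
  obtain q' where q': "mult_op (Suc k) q'" "mult_op 1 ((ad p \<circ> (ad ^^ k) q) - (ad ^^ Suc k) q')"
    using ad_comp_ad_funpow[OF p(1) q(1)] by blast
  interpret T: Vector_Spaces.linear scale scale ?T by (rule linear_rmult) fact
  \<comment> \<open>The word \<open>f\<close> is replaced by \<open>(ad ^^ k) q\<close>, then
    \<open>?T\<close> by \<open>ad p\<close>; composing with an error of degree 1 on either side
    keeps degree 1.\<close>
  have "(?T \<circ> f) - (ad ^^ Suc k) q' = (?T \<circ> (f - (ad ^^ k) q)) + ((?T - ad p) \<circ> (ad ^^ k) q)
      + ((ad p \<circ> (ad ^^ k) q) - (ad ^^ Suc k) q')"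
    by (simp add: fun_eq_iff T.diff)
  moreover have "mult_op 1 (?T \<circ> (f - (ad ^^ k) q))"
    using mult_op.rmult rmult.hyps(1) q(2) by blast
  moreover have "mult_op 1 ((?T - ad p) \<circ> (ad ^^ k) q)"
    using mult_op_comp[OF p(2) mult_op_ad_funpow[OF q(1), of k]] by simp
  ultimately have "mult_op 1 ((?T \<circ> f) - (ad ^^ Suc k) q')"
    using q'(2) by (simp only: mult_op.add)
  with q'(1) show ?case by blast
qed

text \<open>A block of \<open>m + 1\<close> factors is D^(m+1)(q) modulo degree 1, where
  \<open>q\<close> has degree \<open>m + 1\<close> and so vanishes. Each block thus has degree 1,
  and \<open>m + 1\<close> blocks have the vanishing degree \<open>m + 1\<close>.\<close>

lemma ext_word_eq_0:
  assumes "K1_series I m = {0}" and f: "ext_word (Suc m * Suc m) f"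
  shows "f = 0"
proof -
  have vanish: "q = 0" if "mult_op (Suc m) q" for q
    using mult_op_K1_series[OF that] assms(1) by (simp add: fun_eq_iff)
  have ad0: "(ad ^^ k) 0 = 0" for k
    by (induction k) (simp_all only: funpow.simps id_apply comp_apply ad_zero)
  have op1: "mult_op 1 g" if "ext_word (Suc m) g" for g
  proof -
    obtain q where "mult_op (Suc m) q" "mult_op 1 (g - (ad ^^ Suc m) q)"
      using ext_word_ad[OF \<open>ext_word (Suc m) g\<close>] by blast
    moreover from this have "(ad ^^ Suc m) q = 0" using vanish ad0 by blast
    ultimately show ?thesis by simp
  qed
  have "ext_word (j * Suc m) g \<Longrightarrow> mult_op j g" for j g
  proof (induction j arbitrary: g)
    case 0
    then show ?case by (auto elim: ext_word.cases intro: mult_op.id)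
  next
    case (Suc j)
    obtain g1 g2 where "ext_word (Suc m) g1" "ext_word (j * Suc m) g2" "g = g1 \<circ> g2"
      using ext_word_split[OF Suc.prems, of "Suc m" "j * Suc m"] by auto
    then show ?case using mult_op_comp[OF op1 Suc.IH] by (metis plus_1_eq_Suc)
  qed
  then show ?thesis using f vanish by blast
qed

text \<open>Each step of the series applies one more right multiplication with first entry in
  \<open>extended\<close>; by linearity it carries span into span. Nilpotency thus reduces to the
  vanishing of long words.\<close>

lemma K1_series_extended_ext_word:
  "K1_series extended k \<subseteq> span {f x | f x. ext_word k f}"
proof (induction k)
  case 0
  show ?case using ext_word.id by (auto intro!: span_base) (metis id_apply)
next
  case (Suc k)
  let ?S = "span {f x | f x. ext_word (Suc k) f}"
  have "br (x # y # zs) \<in> ?S"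
    if x: "x \<in> K1_series extended k" and y: "y \<in> extended" and zs: "length zs = n - 2" for x y zs
  proof -
    let ?ys = "y # zs"
    have ys: "length ?ys = n - 1" using zs n_ge_2 by simp
    interpret T: Vector_Spaces.linear scale scale "rmult ?ys" by (rule linear_rmult[OF ys])
    have "x \<in> span {f x | f x. ext_word k f}" using x Suc.IH by blast
    then have "rmult ?ys x \<in> ?S"
    proof (rule span_induct)
      show "subspace {x. rmult ?ys x \<in> ?S}"
        using subspace_span unfolding subspace_def
        by (auto simp: T.add T.scale T.zero span_zero span_add span_scale)
      fix u assume "u \<in> {f x | f x. ext_word k f}"
      then obtain f v where "u = f v" "ext_word k f" by blast
      then have "ext_word (Suc k) (rmult ?ys \<circ> f)" "rmult ?ys u = (rmult ?ys \<circ> f) v"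
        using ext_word.rmult[OF ys] y by auto
      then show "rmult ?ys u \<in> ?S" by (blast intro: span_base)
    qed
    then show ?thesis by (simp add: rmult_def)
  qed
  then show ?case
    unfolding K1_series.simps by (intro span_minimal subspace_span) blast
qed

lemma K1_nilpotent_extended:
  assumes "K1_nilpotent I" shows "K1_nilpotent extended"
proof -
  obtain m where m: "K1_series I m = {0}" using assms unfolding K1_nilpotent_def by blast
  let ?k = "Suc m * Suc m"
  have "{f x | f x. ext_word ?k f} \<subseteq> {0}"
    using ext_word_eq_0[OF m] by fastforce
  then have "span {f x | f x. ext_word ?k f} \<subseteq> {0}"
    by (intro span_minimal) (simp_all add: subspace_def)
  then have "K1_series extended ?k = {0}"
    using K1_series_extended_ext_word[of ?k] subspace_0[OF subspace_K1_series[OF ideal_extended, of ?k]]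
    by blast
  then show ?thesis unfolding K1_nilpotent_def by blast
qed

end

section \<open>Passage to the nilradical\<close>

theorem theorem4p10:
  fixes scale :: "'a::field_char_0 \<Rightarrow> 'b::ab_group_add \<Rightarrow> 'b"
    and Basis :: "'b set"
    and n :: nat
    and br :: "'b list \<Rightarrow> 'b"
    and d :: "'b \<Rightarrow> 'b"
  assumes "finite_dimensional_vector_space scale Basis"
    and "leibniz_n_algebra scale n br"
    and "leibniz_n_algebra.derivation scale n br d"
  shows "d ` leibniz_n_algebra.K1_nilradical scale n br \<subseteq> leibniz_n_algebra.K1_nilradical scale n br"
proof -
  interpret leibniz_n_algebra scale n br by fact
  interpret d: Vector_Spaces.linear scale scale d
    using assms(3) by (simp add: derivation_def)
  \<comment> \<open>Since \<open>d\<close> is linear, the generators of the span suffice, and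
    \<open>extended\<close> is itself one of the ideals being summed.\<close>
  have "d x \<in> K1_nilradical" if "ideal I" "K1_nilpotent I" "x \<in> I" for I x
  proof -
    interpret ideal_with_derivation scale n br I d
      using that(1) assms(3) by unfold_locales
    have "d x \<in> extended" "ideal extended" "K1_nilpotent extended"
      using that d_extended ideal_extended K1_nilpotent_extended by auto
    then show ?thesis unfolding K1_nilradical_def by (blast intro: span_base)
  qed
  then have "d ` \<Union>{I. ideal I \<and> K1_nilpotent I} \<subseteq> K1_nilradical" by blast
  then have "span (d ` \<Union>{I. ideal I \<and> K1_nilpotent I}) \<subseteq> K1_nilradical"
    by (rule span_minimal) (simp add: K1_nilradical_def)
  then show ?thesis by (simp add: K1_nilradical_def d.span_image)
qed

end
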